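(* Let $p$ be prime, $m,t\ge1$, $d=t(p-1)$, and let $T$ be Kuhn's triangulation of $R_{p,m}^d$. Let $\lambda:R_{p,m}^d\to R_{p,t}\setminus\{0\}$ be any labeling satisfying $\lambda(\theta x)=\theta\lambda(x)$ for all $x\in\partial R_{p,m}^d$. Then there exist a $(p-1)$-simplex $\{x_1,\dots,x_p\}$ of $T$ and $j\in[t]$ such that $\lambda(x_i)=*^ij$ for all $i\in[p]$.
   Context: For $m\ge1$, $R_{p,m}=\{0\}\cup\{*^ij:i\in\mathbb{Z}_p,j\in[m]\}$ (a "$p$-star": $p$ rays of length $m$ from $0$, the symbols $*^1,\dots,*^p$ being $p$ distinct signs, indices in $[p]$ identified with $\mathbb{Z}_p$), with convention $*^i0=0$. The action is $\theta( *^ij)=*^{i+1}j$, $\theta(0)=0$, extended coordinatewise to $R_{p,m}^d=(R_{p,m})^d$. The boundary $\partial R_{p,m}^d$ is the set of points having at least one coordinate of the form $*^im$. Triangulation: $R_{p,m}^d$ is subdivided into the hypercubes $\{*^{i_1}(a_1-1),*^{i_1}a_1\}\times\dots\times\{*^{i_d}(a_d-1),*^{i_d}a_d\}$ for $a_\ell\in[m]$, $i_\ell\in\mathbb{Z}_p$; each such hypercube (identified with a unit cube via the magnitudes, base point the vertex with all magnitudes $a_\ell-1$) is triangulated by Kuhn's triangulation: for each permutation $\pi$ of $[d]$, the simplex $\{y^0,\dots,y^d\}$ where $y^0$ is the base point and $y^k$ is obtained from $y^{k-1}$ by increasing the magnitude of coordinate $\pi(k)$ by $1$ (along its ray), together with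 all faces. *)

theory Defs
  imports Main "HOL-Library.FuncSet" "HOL-Combinatorics.Permutations"
    "HOL-Computational_Algebra.Primes"
begin

text \<open>
  Points of the \<open>p\<close>-star. Signs, i.e. elements of \<open>\<int>\<^sub>p\<close>, are represented by their residues
  \<open>0, \<dots>, p - 1\<close>; the constructor \<open>Ray\<close> is only used with a reduced sign and a positive magnitude.
\<close>

datatype star_point = Origin | Ray nat nat

text \<open>
  The point \<open>*\<^sup>i j\<close>, for an arbitrary representative \<open>i\<close> of the sign (so \<open>*\<^sup>p j = *\<^sup>0 j\<close>), with the
  convention \<open>*\<^sup>i 0 = 0\<close>.
\<close>

definition sgn_pt :: "nat \<Rightarrow> nat \<Rightarrow> nat \<Rightarrow> star_point" where
  "sgn_pt p i j = (if j = 0 then Origin else Ray (i mod p) j)"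

definition star :: "nat \<Rightarrow> nat \<Rightarrow> star_point set" where
  "star p m = {Origin} \<union> {sgn_pt p i j | i j. i < p \<and> j \<in> {1..m}}"

fun theta :: "nat \<Rightarrow> star_point \<Rightarrow> star_point" where
  "theta p Origin = Origin"
| "theta p (Ray i j) = sgn_pt p (i + 1) j"

lemma theta_sgn_pt: "theta p (sgn_pt p i j) = sgn_pt p (i + 1) j"
  by (simp add: sgn_pt_def mod_Suc_eq)

definition star_pow :: "nat \<Rightarrow> nat \<Rightarrow> nat \<Rightarrow> (nat \<Rightarrow> star_point) set" where
  "star_pow p m d = {1..d} \<rightarrow>\<^sub>E star p m"

definition theta_pow :: "nat \<Rightarrow> nat \<Rightarrow> (nat \<Rightarrow> star_point) \<Rightarrow> (nat \<Rightarrow> star_point)" where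
  "theta_pow p d x = (\<lambda>l\<in>{1..d}. theta p (x l))"

definition star_boundary :: "nat \<Rightarrow> nat \<Rightarrow> nat \<Rightarrow> (nat \<Rightarrow> star_point) set" where
  "star_boundary p m d = {x \<in> star_pow p m d. \<exists>l\<in>{1..d}. \<exists>i<p. x l = sgn_pt p i m}"

text \<open>
  The vertices \<open>y\<^sup>0, \<dots>, y\<^sup>d\<close> of the Kuhn simplex given by a permutation \<open>\<pi>\<close> of \<open>[d]\<close>, in the
  hypercube with signs \<open>s l\<close> whose \<open>l\<close>-th magnitude ranges over \<open>{a l - 1, a l}\<close>. As \<open>\<pi>\<close> hits each
  coordinate once, raising the magnitude of coordinate \<open>\<pi> (Suc k)\<close> by one sets it to \<open>a\<close> there.
\<close>

primrec kuhn_vertex ::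
  "nat \<Rightarrow> nat \<Rightarrow> (nat \<Rightarrow> nat) \<Rightarrow> (nat \<Rightarrow> nat) \<Rightarrow> (nat \<Rightarrow> nat) \<Rightarrow> nat \<Rightarrow> (nat \<Rightarrow> star_point)" where
  "kuhn_vertex p d s a \<pi> 0 = (\<lambda>l\<in>{1..d}. sgn_pt p (s l) (a l - 1))"
| "kuhn_vertex p d s a \<pi> (Suc k) =
     (kuhn_vertex p d s a \<pi> k)(\<pi> (Suc k) := sgn_pt p (s (\<pi> (Suc k))) (a (\<pi> (Suc k))))"

definition kuhn_facets :: "nat \<Rightarrow> nat \<Rightarrow> nat \<Rightarrow> (nat \<Rightarrow> star_point) set set" where
  "kuhn_facets p m d =
     {kuhn_vertex p d s a \<pi> ` {0..d} | s a \<pi>.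
        (\<forall>l\<in>{1..d}. s l < p \<and> a l \<in> {1..m}) \<and> \<pi> permutes {1..d}}"

definition kuhn_triangulation :: "nat \<Rightarrow> nat \<Rightarrow> nat \<Rightarrow> (nat \<Rightarrow> star_point) set set" where
  "kuhn_triangulation p m d = {\<sigma>. \<sigma> \<noteq> {} \<and> (\<exists>\<tau>\<in>kuhn_facets p m d. \<sigma> \<subseteq> \<tau>)}"

end

theory Submission
  imports Defs "HOL-Library.Sublist" "HOL-Number_Theory.Cong"
begin

text \<open>
  Suppose that no simplex is rainbow. Then the labeling maps every simplex into the \<open>t\<close>-fold join
  \<open>K\<close> of the boundary of a \<open>(p - 1)\<close>-simplex, which has dimension \<open>d - 1\<close> and, as \<open>p\<close> is prime, a
  free action of \<open>\<int>\<^sub>p\<close>. Let \<open>\<nu>\<^sub>k\<close> be \<open>\<theta> - 1\<close> for odd \<open>k\<close> and \<open>1 + \<theta> + \<dots> + \<theta>\<^sup>p\<^sup>-\<^sup>1\<close> for even \<open>k\<close>.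
  Freeness yields alternating cochains \<open>\<psi>\<^sub>k\<close> on the \<open>k\<close>-tuples of vertices of \<open>K\<close> with \<open>\<psi>\<^sub>0 = 1\<close> and
  \<open>\<nu>\<^sub>k\<^sub>+\<^sub>1 \<psi>\<^sub>k\<^sub>+\<^sub>1 = \<delta> \<psi>\<^sub>k\<close> modulo \<open>p\<close>. On the other side, there are \<open>k\<close>-chains \<open>Y\<^sub>k\<close> in the first \<open>k\<close>
  coordinates with \<open>\<partial> Y\<^sub>k\<^sub>+\<^sub>1 = \<nu>\<^sub>k\<^sub>+\<^sub>1 W\<^sub>k\<close> and \<open>\<partial> W\<^sub>k = \<partial> Y\<^sub>k\<close>, where \<open>W\<^sub>k\<close> lies in the boundary, on
  which the labeling is equivariant. Hence \<open>\<psi>\<^sub>k (\<lambda> \<partial> Y\<^sub>k)\<close> modulo \<open>p\<close> does not depend on \<open>k\<close>. It is \<open>1\<close>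
  for \<open>k = 0\<close>, but \<open>0\<close> for \<open>k = d\<close>, because \<open>K\<close> has no \<open>d\<close>-simplices.
\<close>

section \<open>Cochains on ordered simplices\<close>

text \<open>Unfolds to the alternating sum over deletions of one entry. Lists of length
  \<open>k\<close> stand for \<open>(k - 1)\<close>-simplices, and \<open>cobd f [x] = f []\<close>,
  so the complex is augmented.\<close>

primrec cobd :: "('a list \<Rightarrow> int) \<Rightarrow> 'a list \<Rightarrow> int" where
  "cobd f [] = 0"
| "cobd f (x # xs) = f xs - cobd (\<lambda>ys. f (x # ys)) xs"

lemma cobd_diff: "cobd (\<lambda>xs. f xs - g xs) xs = cobd f xs - cobd g xs"
  by (induction xs arbitrary: f g) auto

lemma cobd_zero: "cobd (\<lambda>xs. 0) xs = 0"
  by (induction xs) auto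

lemma cobd_uminus: "cobd (\<lambda>xs. - f xs) xs = - cobd f xs"
  using cobd_diff[of "\<lambda>_. 0" f xs] by (simp add: cobd_zero)

lemma cobd_sum: "cobd (\<lambda>xs. \<Sum>i<n. f i xs) xs = (\<Sum>i<(n::nat). cobd (f i) xs)"
  by (induction xs arbitrary: f) (auto simp: sum_subtractf)

lemma cobd_map: "cobd f (map h xs) = cobd (\<lambda>ys. f (map h ys)) xs"
  by (induction xs arbitrary: f) auto

lemma cobd_cobd: "cobd (cobd f) xs = 0"
  by (induction xs arbitrary: f) (auto simp: cobd_diff)

lemma cobd_dvd:
  assumes "\<And>ys. set ys \<subseteq> set xs \<Longrightarrow> q dvd f ys"
  shows "q dvd cobd f xs"
  using assms
proof (induction xs arbitrary: f)
  case (Cons x xs)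
  have "q dvd cobd (\<lambda>ys. f (x # ys)) xs"
    by (rule Cons.IH) (auto intro!: Cons.prems)
  moreover have "q dvd f xs"
    by (rule Cons.prems) auto
  ultimately show ?case by simp
qed auto

section \<open>Alternating cochains\<close>

definition alternating :: "('a list \<Rightarrow> int) \<Rightarrow> bool" where
  "alternating f \<longleftrightarrow> (\<forall>xs a b ys. f (xs @ a # b # ys) = - f (xs @ b # a # ys)) \<and>
     (\<forall>xs a ys. f (xs @ a # a # ys) = 0)"

lemma alternating_swap: "alternating f \<Longrightarrow> f (xs @ a # b # ys) = - f (xs @ b # a # ys)"
  unfolding alternating_def by blast

lemma alternating_adjacent: "alternating f \<Longrightarrow> f (xs @ a # a # ys) = 0"
  unfolding alternating_def by blast

lemma alternating_Cons: "alternating f \<Longrightarrow> alternating (\<lambda>ys. f (x # ys))"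
  unfolding alternating_def by (metis append_Cons)

lemma alternating_repeated:
  assumes "alternating f"
  shows "f (xs @ a # zs @ a # ys) = 0"
proof (induction zs arbitrary: xs)
  case Nil
  then show ?case using assms by (simp add: alternating_adjacent)
next
  case (Cons z zs)
  have "f (xs @ a # z # (zs @ a # ys)) = - f (xs @ z # a # (zs @ a # ys))"
    by (rule alternating_swap[OF assms])
  also have "\<dots> = 0" using Cons[of "xs @ [z]"] by simp
  finally show ?case by simp
qed

lemma alternating_not_distinct:
  assumes "alternating f" "\<not> distinct xs"
  shows "f xs = 0"
proof -
  obtain us a vs ws where "xs = us @ [a] @ vs @ [a] @ ws"
    using not_distinct_decomp[OF assms(2)] by blast
  then show ?thesis using alternating_repeated[OF assms(1)] by simp
qed

text \<open>Deleting \<open>a\<close> or \<open>b\<close> gives two terms of opposite sign that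
  trade places under the swap and cancel if \<open>a = b\<close>; every other deletion leaves the
  adjacent pair inside \<open>f\<close>.\<close>

lemma alternating_cobd:
  assumes "alternating f"
  shows "alternating (cobd f)"
proof -
  have "cobd f (xs @ a # b # ys) = - cobd f (xs @ b # a # ys)" for xs a b ys
    using assms
  proof (induction xs arbitrary: f)
    case Nil
    have "(\<lambda>zs. f (a # b # zs)) = (\<lambda>zs. - f (b # a # zs))"
      using alternating_swap[OF Nil, of "[]" a b] by auto
    then show ?case
      by (simp add: cobd_uminus)
  next
    case (Cons x xs)
    then show ?case
      using Cons.IH[OF alternating_Cons[OF Cons.prems]]
        alternating_swap[OF Cons.prems, of xs a b ys]
      by simp
  qed
  moreover have "cobd f (xs @ a # a # ys) = 0" for xs a ys
    using assms
  proof (induction xs arbitrary: f)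
    case Nil
    have "(\<lambda>zs. f (a # a # zs)) = (\<lambda>zs. 0)"
      using alternating_adjacent[OF Nil, of "[]"] by auto
    then show ?case by (simp add: cobd_zero)
  next
    case (Cons x xs)
    then show ?case
      using Cons.IH[OF alternating_Cons[OF Cons.prems]] alternating_adjacent[OF Cons.prems]
      by simp
  qed
  ultimately show ?thesis unfolding alternating_def by blast
qed

text \<open>The dual of the triangulated prism with bottom \<open>map u xs\<close> and top \<open>map w xs\<close>.\<close>

primrec prism :: "('a \<Rightarrow> 'b) \<Rightarrow> ('a \<Rightarrow> 'b) \<Rightarrow> ('b list \<Rightarrow> int) \<Rightarrow> 'a list \<Rightarrow> int" where
  "prism u w f [] = 0"
| "prism u w f (x # xs) = f (u x # w x # map w xs) - prism u w (\<lambda>ys. f (u x # ys)) xs"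

lemma prism_diff: "prism u w (\<lambda>xs. f xs - g xs) xs = prism u w f xs - prism u w g xs"
  by (induction xs arbitrary: f g) auto

lemma prism_dvd:
  assumes "\<And>ys x zs. xs = ys @ x # zs \<Longrightarrow> q dvd f (map u ys @ u x # w x # map w zs)"
  shows "q dvd prism u w f xs"
  using assms
proof (induction xs arbitrary: f)
  case (Cons x xs)
  have "q dvd prism u w (\<lambda>ys. f (u x # ys)) xs"
  proof (rule Cons.IH)
    fix ys y zs assume "xs = ys @ y # zs"
    then show "q dvd f (u x # map u ys @ u y # w y # map w zs)"
      using Cons.prems[of "x # ys" y zs] by simp
  qed
  then show ?case using Cons.prems[of "[]" x xs] by simp
qed auto

text \<open>Dual to the fact that the boundary of a prism is its top minus its bottom minus the
  prism over the boundary; faces shared by consecutive simplices cancel.\<close>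

lemma prism_cobd:
  "prism u w (cobd f) xs = f (map w xs) - f (map u xs) - cobd (prism u w f) xs"
  by (induction xs arbitrary: f) (auto simp: prism_diff cobd_diff cobd_map)

section \<open>Cochains with a cyclic action\<close>

definition tau :: "('a \<Rightarrow> 'a) \<Rightarrow> ('a list \<Rightarrow> int) \<Rightarrow> 'a list \<Rightarrow> int" where
  "tau th f xs = f (map th xs) - f xs"

definition nrm :: "('a \<Rightarrow> 'a) \<Rightarrow> nat \<Rightarrow> ('a list \<Rightarrow> int) \<Rightarrow> 'a list \<Rightarrow> int" where
  "nrm th p f xs = (\<Sum>i<p. f (map (th ^^ i) xs))"

definition nu :: "('a \<Rightarrow> 'a) \<Rightarrow> nat \<Rightarrow> nat \<Rightarrow> ('a list \<Rightarrow> int) \<Rightarrow> 'a list \<Rightarrow> int" where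
  "nu th p k = (if odd k then tau th else nrm th p)"

lemma nu_diff: "nu th p k (\<lambda>xs. f xs - g xs) xs = nu th p k f xs - nu th p k g xs"
  by (simp add: nu_def tau_def nrm_def sum_subtractf)

lemma nu_cobd: "nu th p k (cobd f) xs = cobd (nu th p k f) xs"
  by (simp add: nu_def tau_def[abs_def] nrm_def[abs_def] cobd_map cobd_diff cobd_sum)

lemma nu_dvd:
  assumes "\<And>i. q dvd f (map (th ^^ i) xs)"
  shows "q dvd nu th p k f xs"
  using assms[of 0] assms[of 1] assms
  by (auto simp: nu_def tau_def nrm_def intro!: dvd_sum)

text \<open>In either order the composite telescopes to \<open>th ^^ p\<close> minus the
  identity.\<close>

lemma nu_nu:
  assumes "\<And>x. x \<in> set xs \<Longrightarrow> (th ^^ p) x = x"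
  shows "nu th p k (nu th p (Suc k) f) xs = 0"
proof -
  have per: "map (th ^^ p) xs = xs"
    using assms by (simp add: map_idI)
  have "(\<Sum>i<p. f (map (th ^^ Suc i) xs) - f (map (th ^^ i) xs)) = 0"
    by (subst sum_lessThan_telescope) (simp add: per)
  then show ?thesis
    by (auto simp: nu_def tau_def nrm_def sum_subtractf funpow_swap1 o_def)
qed

text \<open>Shifting by \<open>p - n (set xs)\<close> leads to the orbit representative, where
  \<open>n\<close> is \<open>0\<close>. To invert \<open>tau\<close>, the coboundary is summed along
  the orbit from the representative up to, but excluding, \<open>xs\<close>; to invert
  \<open>nrm\<close>, it is kept on representatives only.\<close>

primrec label_cochain ::
  "('a \<Rightarrow> 'a) \<Rightarrow> nat \<Rightarrow> ('a set \<Rightarrow> nat) \<Rightarrow> nat \<Rightarrow> 'a list \<Rightarrow> int" where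
  "label_cochain th p n 0 = (\<lambda>xs. if xs = [] then 1 else 0)"
| "label_cochain th p n (Suc k) = (\<lambda>xs.
     if even k
     then \<Sum>i<n (set xs). cobd (label_cochain th p n k) (map (th ^^ (p - n (set xs) + i)) xs)
     else if n (set xs) = 0 then cobd (label_cochain th p n k) xs else 0)"

declare label_cochain.simps(2) [simp del]

text \<open>As \<open>n\<close> depends only on the set of entries, reordering a list changes
  neither the case nor the shifts.\<close>

lemma alternating_label_cochain: "alternating (label_cochain th p n k)"
proof (induction k)
  case 0
  then show ?case by (simp add: alternating_def)
next
  case (Suc k)
  note alt = alternating_cobd[OF Suc]
  have "label_cochain th p n (Suc k) (xs @ a # b # ys)
      = - label_cochain th p n (Suc k) (xs @ b # a # ys)" for xs a b ys
  proof -
    have "set (xs @ a # b # ys) = set (xs @ b # a # ys)"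
      by auto
    moreover have "cobd (label_cochain th p n k) (map h (xs @ a # b # ys))
        = - cobd (label_cochain th p n k) (map h (xs @ b # a # ys))" for h
      using alternating_swap[OF alt, of "map h xs" "h a" "h b" "map h ys"] by simp
    ultimately show ?thesis
      using alternating_swap[OF alt, of xs a b ys]
      by (simp only: label_cochain.simps sum_negf split: if_split) simp
  qed
  moreover have "label_cochain th p n (Suc k) (xs @ a # a # ys) = 0" for xs a ys
    unfolding label_cochain.simps using alternating_adjacent[OF alt] by simp
  ultimately show ?case unfolding alternating_def by blast
qed

text \<open>
  The equivariant map \<open>n\<close> from the nonempty simplices to \<open>\<int>\<^sub>p\<close> witnesses that the action is free;
  it selects the orbit representatives on which the cochains are defined.
\<close>

locale free_cyclic_complex =
  fixes th :: "'a \<Rightarrow> 'a" and p :: nat and good :: "'a set \<Rightarrow> bool" and n :: "'a set \<Rightarrow> nat"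
  assumes p_pos: "0 < p"
    and good_subset: "good S \<Longrightarrow> R \<subseteq> S \<Longrightarrow> good R"
    and good_image: "good S \<Longrightarrow> good (th ` S)"
    and period: "good S \<Longrightarrow> x \<in> S \<Longrightarrow> (th ^^ p) x = x"
    and n_less: "n S < p"
    and n_image: "good S \<Longrightarrow> S \<noteq> {} \<Longrightarrow> n (th ` S) = (n S + 1) mod p"
begin

lemma good_funpow: "good S \<Longrightarrow> good ((th ^^ i) ` S)"
proof (induction i)
  case (Suc i)
  then show ?case using good_image[of "(th ^^ i) ` S"] by (simp add: image_comp)
qed simp

lemma n_funpow:
  assumes "good S" "S \<noteq> {}"
  shows "n ((th ^^ i) ` S) = (n S + i) mod p"
proof (induction i)
  case 0
  then show ?case using n_less[of S] by simp
next
  case (Suc i)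
  have "n (th ` ((th ^^ i) ` S)) = (n ((th ^^ i) ` S) + 1) mod p"
    by (rule n_image) (use assms good_funpow in auto)
  then show ?case
    by (simp add: Suc image_comp mod_Suc_eq)
qed

lemma map_period: "good (set xs) \<Longrightarrow> map (th ^^ p) xs = xs"
  by (simp add: map_idI period)

text \<open>Passing from \<open>xs\<close> to \<open>map th xs\<close> adds the summand
  \<open>F xs\<close>, unless the orbit wraps round to its representative. There \<open>G\<close>
  drops to \<open>0\<close>, and \<open>G xs + F xs\<close> is the full norm, which is divisible by
  \<open>p\<close>.\<close>

lemma tau_solution:
  assumes good: "good (set xs)" and zero: "int p dvd nrm th p F xs" and "xs \<noteq> []"
    and G: "\<And>ys. G ys = (\<Sum>i<n (set ys). F (map (th ^^ (p - n (set ys) + i)) ys))"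
  shows "int p dvd tau th G xs - F xs"
proof -
  define r where "r = n (set xs)"
  have r: "r < p" unfolding r_def by (rule n_less)
  have r': "n (set (map th xs)) = (r + 1) mod p"
    using n_image[OF good] \<open>xs \<noteq> []\<close> by (simp add: r_def)
  show ?thesis
  proof (cases "r + 1 < p")
    case True
    have "G (map th xs) = (\<Sum>i<Suc r. F (map (th ^^ (p - Suc r + i)) (map th xs)))"
      using True by (simp only: G r') simp
    also have "\<dots> = (\<Sum>i<Suc r. F (map (th ^^ (p - r + i)) xs))"
    proof (rule sum.cong)
      fix i
      have "th ^^ (p - Suc r + i) \<circ> th = th ^^ (p - r + i)"
        using r by (simp add: funpow_Suc_right[symmetric] Suc_diff_Suc del: funpow.simps)
      then show "F (map (th ^^ (p - Suc r + i)) (map th xs)) = F (map (th ^^ (p - r + i)) xs)"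
        by simp
    qed simp
    also have "\<dots> = G xs + F xs"
      using r map_period[OF good] by (simp add: G r_def[symmetric])
    finally show ?thesis by (simp add: tau_def)
  next
    case False
    then have p: "p = Suc r" using r by simp
    have "G (map th xs) = 0" using p by (simp only: G r') simp
    moreover have "nrm th p F xs = F xs + G xs"
      unfolding nrm_def p sum.lessThan_Suc_shift
      by (simp add: G r_def[symmetric] p)
    ultimately show ?thesis
      using zero unfolding tau_def
      by (metis add.commute diff_0 dvd_minus_iff minus_add_distrib uminus_add_conv_diff)
  qed
qed

text \<open>Exactly one of the \<open>p\<close> shifts of \<open>xs\<close> is a representative, so
  the norm of \<open>G\<close> is the value of \<open>F\<close> there. Modulo \<open>p\<close> this
  is \<open>F xs\<close>, by invariance of \<open>F\<close>.\<close>

lemma nrm_solution: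
  assumes good: "good (set xs)" and "xs \<noteq> []"
    and zero: "\<And>ys. good (set ys) \<Longrightarrow> int p dvd tau th F ys"
    and G: "\<And>ys. G ys = (if n (set ys) = 0 then F ys else 0)"
  shows "int p dvd nrm th p G xs - F xs"
proof -
  define r where "r = n (set xs)"
  have r: "r < p" unfolding r_def by (rule n_less)
  define i0 where "i0 = (if r = 0 then 0 else p - r)"
  have i0: "i0 < p" using r p_pos by (auto simp: i0_def)
  have iff: "(r + i) mod p = 0 \<longleftrightarrow> i = i0" if "i < p" for i
  proof (cases "r + i < p")
    case True
    then show ?thesis using that by (auto simp: i0_def)
  next
    case False
    then have "(r + i) mod p = r + i - p"
      using r that by (simp add: le_mod_geq)
    then show ?thesis using False r that by (auto simp: i0_def)
  qed
  have "nrm th p G xs = (\<Sum>i<p. if i = i0 then F (map (th ^^ i) xs) else 0)"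
    unfolding nrm_def
  proof (rule sum.cong)
    fix i assume "i \<in> {..<p}"
    then show "G (map (th ^^ i) xs) = (if i = i0 then F (map (th ^^ i) xs) else 0)"
      using n_funpow[OF good, of i] \<open>xs \<noteq> []\<close> iff[of i] by (simp add: G r_def)
  qed simp
  also have "\<dots> = F (map (th ^^ i0) xs)" using i0 by simp
  finally have *: "nrm th p G xs = F (map (th ^^ i0) xs)" .
  have "int p dvd F (map (th ^^ i) xs) - F xs" for i
  proof (induction i)
    case (Suc i)
    have "int p dvd tau th F (map (th ^^ i) xs)"
      by (rule zero) (use good_funpow good in auto)
    then have "int p dvd F (map (th ^^ Suc i) xs) - F (map (th ^^ i) xs)"
      by (simp add: tau_def)
    from dvd_add[OF this Suc] show ?case by (simp add: o_def)
  qed auto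
  then show ?thesis by (simp add: *)
qed

text \<open>The solution lemmas require the other operator to kill the coboundary. It does:
  \<open>nu\<close> commutes with \<open>cobd\<close>, so the induction hypothesis reduces this to
  \<open>cobd_cobd\<close>. In the base case, the norm of an invariant cochain is \<open>p\<close>
  times that cochain.\<close>

lemma nu_label_cochain:
  "good (set xs) \<Longrightarrow> int p dvd
     nu th p (Suc k) (label_cochain th p n (Suc k)) xs - cobd (label_cochain th p n k) xs"
proof (induction k arbitrary: xs)
  case 0
  show ?case
  proof (cases "xs = []")
    case False
    have "cobd (label_cochain th p n 0) (map h ys) = cobd (label_cochain th p n 0) ys" for h ys
      by (simp add: cobd_map)
    then have "nrm th p (cobd (label_cochain th p n 0)) xs
        = int p * cobd (label_cochain th p n 0) xs"
      by (simp add: nrm_def)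
    then show ?thesis
      using tau_solution[OF 0 _ False, of "cobd (label_cochain th p n 0)"
          "label_cochain th p n (Suc 0)"]
      by (simp add: nu_def label_cochain.simps(2)[of _ _ _ 0])
  qed (simp add: nu_def tau_def)
next
  case (Suc k)
  let ?F = "cobd (label_cochain th p n (Suc k))"
  have zero: "int p dvd nu th p (Suc k) ?F ys" if "good (set ys)" for ys
  proof -
    have "int p dvd cobd (\<lambda>ys. nu th p (Suc k) (label_cochain th p n (Suc k)) ys
        - cobd (label_cochain th p n k) ys) ys"
      by (rule cobd_dvd, rule Suc.IH) (use good_subset that in blast)
    then show ?thesis by (simp add: nu_cobd cobd_diff cobd_cobd)
  qed
  show ?case
  proof (cases "xs = []")
    case True
    then show ?thesis by (simp add: nu_def tau_def nrm_def)
  next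
    case False
    show ?thesis
    proof (cases "even k")
      case True
      have "int p dvd nrm th p (label_cochain th p n (Suc (Suc k))) xs - ?F xs"
      proof (rule nrm_solution[OF Suc.prems False])
        show "int p dvd tau th ?F ys" if "good (set ys)" for ys
          using zero[OF that] True by (simp add: nu_def)
      qed (use True in \<open>simp add: label_cochain.simps(2)[of _ _ _ "Suc k"]\<close>)
      then show ?thesis using True by (simp add: nu_def)
    next
      case k: False
      have "int p dvd tau th (label_cochain th p n (Suc (Suc k))) xs - ?F xs"
      proof (rule tau_solution[OF Suc.prems _ False])
        show "int p dvd nrm th p ?F xs"
          using zero[OF Suc.prems] k by (simp add: nu_def)
      qed (use k in \<open>simp add: label_cochain.simps(2)[of _ _ _ "Suc k"]\<close>)
      then show ?thesis using k by (simp add: nu_def)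
    qed
  qed
qed

end

section \<open>The Kuhn chains\<close>

lemma sgn_pt_in_star:
  assumes "0 < p" "j \<le> m"
  shows "sgn_pt p i j \<in> star p m"
proof (cases "j = 0")
  case False
  then have "sgn_pt p i j = sgn_pt p (i mod p) j \<and> i mod p < p \<and> j \<in> {1..m}"
    using assms by (simp add: sgn_pt_def)
  then show ?thesis unfolding star_def by blast
qed (simp add: sgn_pt_def star_def)

lemma theta_funpow_sgn_pt: "(theta p ^^ i) (sgn_pt p s j) = sgn_pt p (s + i) j"
  by (induction i) (auto simp: theta_sgn_pt)

lemma theta_period:
  assumes "x \<in> star p m"
  shows "(theta p ^^ p) x = x"
proof (cases "x = Origin")
  case True
  then show ?thesis using theta_funpow_sgn_pt[of p p 0 0] by (simp add: sgn_pt_def)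
next
  case False
  then obtain i j where "x = sgn_pt p i j" using assms by (auto simp: star_def)
  then show ?thesis by (simp add: theta_funpow_sgn_pt) (simp add: sgn_pt_def)
qed

lemma theta_pow_funpow:
  assumes "x \<in> star_pow p m d"
  shows "(theta_pow p d ^^ i) x = (\<lambda>l\<in>{1..d}. (theta p ^^ i) (x l))"
proof (induction i)
  case 0
  then show ?case using assms by (auto simp: star_pow_def)
next
  case (Suc i)
  then show ?case by (auto simp: theta_pow_def)
qed

lemma theta_pow_period:
  assumes "x \<in> star_pow p m d"
  shows "(theta_pow p d ^^ p) x = x"
proof
  fix l
  show "(theta_pow p d ^^ p) x l = x l"
    using assms theta_period[of "x l" p m]
    by (cases "l \<in> {1..d}") (auto simp: theta_pow_funpow[OF assms] star_pow_def PiE_def Pi_def extensional_def)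
qed

locale star_grid =
  fixes p m d :: nat
  assumes p_pos: "0 < p" and m_pos: "1 \<le> m"
begin

abbreviation rot :: "(nat \<Rightarrow> star_point) \<Rightarrow> (nat \<Rightarrow> star_point)" where
  "rot \<equiv> theta_pow p d"

text \<open>Sign \<open>0\<close> only: the other rays arise from the rotations in
  \<open>nu\<close>.\<close>

definition put :: "nat \<Rightarrow> nat \<Rightarrow> (nat \<Rightarrow> star_point) \<Rightarrow> (nat \<Rightarrow> star_point)" where
  "put c b x = x(c := sgn_pt p 0 b)"

definition sweep :: "nat \<Rightarrow> ((nat \<Rightarrow> star_point) list \<Rightarrow> int) \<Rightarrow> (nat \<Rightarrow> star_point) list \<Rightarrow> int" where
  "sweep c f xs = (\<Sum>b<m. prism (put c b) (put c (Suc b)) f xs)"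

text \<open>
  The chain \<open>Y\<^sub>k\<close> as a functional on cochains: \<open>Y\<^sub>k\<^sub>+\<^sub>1 = \<nu>\<^sub>k\<^sub>+\<^sub>1 (Y\<^sub>k \<times> r)\<close>, where \<open>r\<close> is the ray of
  sign \<open>0\<close> in coordinate \<open>k + 1\<close>.
\<close>

primrec chain :: "nat \<Rightarrow> ((nat \<Rightarrow> star_point) list \<Rightarrow> int) \<Rightarrow> int" where
  "chain 0 f = f [\<lambda>l\<in>{1..d}. Origin]"
| "chain (Suc k) f = chain k (sweep (Suc k) (nu rot p (Suc k) f))"

text \<open>
  \<open>J l\<close> is the step at which coordinate \<open>l\<close> increases, so \<open>J\<close> is the inverse of the permutation
  of a Kuhn simplex; the coordinates beyond \<open>k\<close> are \<open>0\<close>.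
\<close>

definition vert ::
  "(nat \<Rightarrow> nat) \<Rightarrow> (nat \<Rightarrow> nat) \<Rightarrow> (nat \<Rightarrow> nat) \<Rightarrow> nat \<Rightarrow> nat \<Rightarrow> nat \<Rightarrow> star_point" where
  "vert s a J k i = (\<lambda>l\<in>{1..d}.
     if l \<le> k then sgn_pt p (s l) (if i < J l then a l - 1 else a l) else Origin)"

definition kuhn_list :: "nat \<Rightarrow> (nat \<Rightarrow> star_point) list \<Rightarrow> bool" where
  "kuhn_list k xs \<longleftrightarrow> (\<exists>s a J. (\<forall>l\<in>{1..k}. s l < p \<and> a l \<in> {1..m} \<and> J l \<in> {1..k}) \<and>
     inj_on J {1..k} \<and> xs = map (vert s a J k) [0..<Suc k])"

lemma kuhn_listE:
  assumes "kuhn_list k xs"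
  obtains s a J where "\<forall>l\<in>{1..k}. s l < p \<and> a l \<in> {1..m} \<and> J l \<in> {1..k}"
    "inj_on J {1..k}" "xs = map (vert s a J k) [0..<Suc k]"
  using assms unfolding kuhn_list_def by blast

lemma kuhn_list_0: "kuhn_list 0 [\<lambda>l\<in>{1..d}. Origin]"
  unfolding kuhn_list_def by (auto simp: vert_def restrict_def intro!: exI[of _ "\<lambda>_. 0"])

lemma kuhn_list_map_rot:
  assumes "kuhn_list k xs"
  shows "kuhn_list k (map rot xs)"
proof -
  obtain s a J where *: "\<forall>l\<in>{1..k}. s l < p \<and> a l \<in> {1..m} \<and> J l \<in> {1..k}"
    "inj_on J {1..k}" "xs = map (vert s a J k) [0..<Suc k]"
    by (rule kuhn_listE[OF assms])
  define s' where "s' = (\<lambda>l. (s l + 1) mod p)"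
  have "rot (vert s a J k i) = vert s' a J k i" for i
  proof
    fix l
    have "theta p (sgn_pt p (s l) j) = sgn_pt p (s' l) j" for j
      by (simp add: theta_sgn_pt) (simp add: sgn_pt_def s'_def)
    then show "rot (vert s a J k i) l = vert s' a J k i l"
      by (simp add: theta_pow_def vert_def)
  qed
  then have "map rot xs = map (vert s' a J k) [0..<Suc k]"
    by (simp add: *(3))
  moreover have "\<forall>l\<in>{1..k}. s' l < p \<and> a l \<in> {1..m} \<and> J l \<in> {1..k}"
    using *(1) p_pos by (simp add: s'_def)
  ultimately show ?thesis using *(2) unfolding kuhn_list_def by blast
qed

lemma kuhn_list_map_funpow: "kuhn_list k xs \<Longrightarrow> kuhn_list k (map (rot ^^ i) xs)"
proof (induction i)
  case (Suc i)
  then show ?case using kuhn_list_map_rot[of k "map (rot ^^ i) xs"] by (simp add: o_def)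
qed simp

lemma kuhn_list_star_pow:
  assumes "kuhn_list k xs"
  shows "set xs \<subseteq> star_pow p m d"
proof -
  obtain s a J where *: "\<forall>l\<in>{1..k}. s l < p \<and> a l \<in> {1..m} \<and> J l \<in> {1..k}"
    "inj_on J {1..k}" "xs = map (vert s a J k) [0..<Suc k]"
    by (rule kuhn_listE[OF assms])
  have "a l - Suc 0 \<le> m \<and> a l \<le> m" if "Suc 0 \<le> l" "l \<le> k" for l
    using *(1)[rule_format, of l] that by auto
  then have "vert s a J k i \<in> star_pow p m d" for i
    using p_pos sgn_pt_in_star[of p 0 m 0]
    by (auto simp: vert_def star_pow_def sgn_pt_def[of p 0 0] intro!: sgn_pt_in_star)
  then show ?thesis by (auto simp: *(3))
qed

lemma kuhn_list_prism:
  assumes "kuhn_list k (ys @ x # zs)" "Suc k \<le> d" "b < m"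
  shows "kuhn_list (Suc k) (map (put (Suc k) b) ys @ put (Suc k) b x # put (Suc k) (Suc b) x #
    map (put (Suc k) (Suc b)) zs)" (is "kuhn_list _ ?ws")
proof -
  obtain s a J where *: "\<forall>l\<in>{1..k}. s l < p \<and> a l \<in> {1..m} \<and> J l \<in> {1..k}"
    "inj_on J {1..k}" "ys @ x # zs = map (vert s a J k) [0..<Suc k]"
    by (rule kuhn_listE[OF assms(1)])
  define i where "i = length ys"
  define s' where "s' = s(Suc k := 0)"
  define a' where "a' = a(Suc k := Suc b)"
  \<comment> \<open>The prism simplex that doubles \<open>x\<close> raises the new coordinate right
    after position \<open>i\<close> of \<open>x\<close>; all later steps are delayed by one.\<close>
  define J' where "J' = (\<lambda>l. if l = Suc k then Suc i else if J l \<le> i then J l else Suc (J l))"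
  have len: "length ys + length zs = k"
    using arg_cong[OF *(3), of length] by simp
  have nth: "(ys @ x # zs) ! n = vert s a J k n" if "n \<le> k" for n
    using that by (simp only: *(3) nth_map length_upt) (simp del: upt_Suc)
  have low: "put (Suc k) b (vert s a J k n) = vert s' a' J' (Suc k) n" if "n \<le> i" for n
    using that assms(2) by (auto simp: put_def vert_def s'_def a'_def J'_def fun_eq_iff)
  have high: "put (Suc k) (Suc b) (vert s a J k n) = vert s' a' J' (Suc k) (Suc n)" if "i \<le> n" for n
    using that assms(2) by (auto simp: put_def vert_def s'_def a'_def J'_def fun_eq_iff)
  have "?ws = map (vert s' a' J' (Suc k)) [0..<Suc (Suc k)]"
  proof (rule nth_equalityI)
    show "length ?ws = length (map (vert s' a' J' (Suc k)) [0..<Suc (Suc k)])"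
      using len by simp
    fix n assume "n < length ?ws"
    then have n: "n \<le> Suc k" using len by simp
    have "?ws ! n = vert s' a' J' (Suc k) n"
    proof (cases "n \<le> i")
      case True
      then have "?ws ! n = put (Suc k) b ((ys @ x # zs) ! n)"
        by (auto simp: nth_append i_def)
      then show ?thesis using low[OF True] nth[of n] True len by (simp add: i_def)
    next
      case False
      then obtain n' where n': "n = Suc n'" "i \<le> n'" by (cases n) auto
      then have "?ws ! n = put (Suc k) (Suc b) ((ys @ x # zs) ! n')"
        using n len by (auto simp: nth_append i_def nth_Cons Suc_diff_le split: nat.split)
      then show ?thesis using high[OF n'(2)] nth[of n'] n n' by simp
    qed
    then show "?ws ! n = map (vert s' a' J' (Suc k)) [0..<Suc (Suc k)] ! n"
      using n by (simp del: upt_Suc)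
  qed
  moreover have "\<forall>l\<in>{1..Suc k}. s' l < p \<and> a' l \<in> {1..m} \<and> J' l \<in> {1..Suc k}"
    using *(1) p_pos assms(3) len by (auto simp: s'_def a'_def J'_def i_def)
  moreover have "inj_on J' {1..Suc k}"
  proof (rule inj_onI)
    fix l l' assume l: "l \<in> {1..Suc k}" "l' \<in> {1..Suc k}" "J' l = J' l'"
    show "l = l'"
    proof (cases "l = Suc k \<or> l' = Suc k")
      case True
      then show ?thesis using l(3) by (auto simp: J'_def split: if_splits)
    next
      case False
      then have "J l = J l'" using l(3) by (auto simp: J'_def split: if_splits)
      then show ?thesis using inj_onD[OF *(2)] l False by auto
    qed
  qed
  ultimately show ?thesis unfolding kuhn_list_def by blast
qed

lemma kuhn_list_put_0:
  assumes "kuhn_list k xs" "Suc k \<le> d"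
  shows "map (put (Suc k) 0) xs = xs"
proof -
  obtain s a J where "xs = map (vert s a J k) [0..<Suc k]"
    by (rule kuhn_listE[OF assms(1)])
  moreover have "put (Suc k) 0 (vert s a J k i) = vert s a J k i" for i
    using assms(2) by (auto simp: put_def vert_def sgn_pt_def)
  ultimately show ?thesis by simp
qed

text \<open>Since \<open>J\<close> inverts \<open>\<pi>\<close>, exactly the coordinates with
  \<open>J l \<le> i\<close> have been raised after \<open>i\<close> steps.\<close>

lemma kuhn_vertex_vert:
  assumes J: "\<And>l. l \<in> {1..d} \<Longrightarrow> J l \<in> {1..d} \<and> \<pi> (J l) = l"
    and \<pi>: "\<And>l. l \<in> {1..d} \<Longrightarrow> \<pi> l \<in> {1..d} \<and> J (\<pi> l) = l" and "i \<le> d"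
  shows "kuhn_vertex p d s a \<pi> i = vert s a J d i"
  using \<open>i \<le> d\<close>
proof (induction i)
  case 0
  show ?case using J by (fastforce simp: vert_def)
next
  case (Suc i)
  then have S: "Suc i \<in> {1..d}" by simp
  have "i < J l \<longleftrightarrow> Suc i < J l" if "l \<noteq> \<pi> (Suc i)" "l \<in> {1..d}" for l
    using J[OF that(2)] that(1) by (metis Suc_lessI less_Suc_eq not_less_eq)
  then show ?case
    using Suc \<pi>[OF S] by (auto simp: vert_def fun_eq_iff)
qed

lemma kuhn_list_facet:
  assumes "kuhn_list k xs" "k \<le> d"
  shows "\<exists>\<tau>\<in>kuhn_facets p m d. set xs \<subseteq> \<tau>"
proof -
  obtain s a J where *: "\<forall>l\<in>{1..k}. s l < p \<and> a l \<in> {1..m} \<and> J l \<in> {1..k}"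
    "inj_on J {1..k}" "xs = map (vert s a J k) [0..<Suc k]"
    by (rule kuhn_listE[OF assms(1)])
  define s' where "s' = (\<lambda>l. if l \<le> k then s l else 0)"
  \<comment> \<open>Coordinates beyond \<open>k\<close> have upper magnitude \<open>1\<close> and
    are raised only at step \<open>l > k\<close>, so they are \<open>Origin\<close> in the first
    \<open>k + 1\<close> vertices.\<close>
  define a' where "a' = (\<lambda>l. if l \<le> k then a l else 1)"
  define J' where "J' = (\<lambda>l. if l \<le> k then J l else l)"
  define \<pi> where "\<pi> = (\<lambda>l. if l \<in> {1..d} then inv_into {1..d} J' l else l)"
  have sub: "J' ` {1..d} \<subseteq> {1..d}"
    using *(1) assms(2) by (fastforce simp: J'_def)
  have inj: "inj_on J' {1..d}"
  proof (rule inj_onI)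
    fix x y assume xy: "x \<in> {1..d}" "y \<in> {1..d}" "J' x = J' y"
    then show "x = y"
      using *(1)[rule_format, of x] *(1)[rule_format, of y] inj_onD[OF *(2), of x y]
      by (auto simp: J'_def split: if_splits)
  qed
  have img: "J' ` {1..d} = {1..d}"
    by (rule endo_inj_surj[OF _ sub inj]) simp
  have J'1: "J' l \<in> {1..d} \<and> \<pi> (J' l) = l" if "l \<in> {1..d}" for l
  proof -
    have "J' l \<in> {1..d}" using that sub by blast
    then show ?thesis using that inj by (simp add: \<pi>_def)
  qed
  have \<pi>1: "\<pi> l \<in> {1..d} \<and> J' (\<pi> l) = l" if "l \<in> {1..d}" for l
    using that img by (metis \<pi>_def f_inv_into_f inv_into_into)
  have "bij_betw \<pi> {1..d} {1..d}"
    by (rule bij_betw_byWitness[of _ J']) (use J'1 \<pi>1 in auto)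
  then have "\<pi> permutes {1..d}"
    by (rule bij_imp_permutes) (auto simp: \<pi>_def)
  moreover have "\<forall>l\<in>{1..d}. s' l < p \<and> a' l \<in> {1..m}"
    using *(1) p_pos m_pos by (auto simp: s'_def a'_def)
  ultimately have "kuhn_vertex p d s' a' \<pi> ` {0..d} \<in> kuhn_facets p m d"
    unfolding kuhn_facets_def by blast
  moreover have "set xs \<subseteq> kuhn_vertex p d s' a' \<pi> ` {0..d}"
  proof
    fix x assume "x \<in> set xs"
    then obtain i where "i \<in> set [0..<Suc k]" and x: "x = vert s a J k i"
      unfolding *(3) set_map by blast
    then have i: "i \<le> k" by auto
    have "vert s a J k i = vert s' a' J' d i"
      using i by (auto simp: vert_def s'_def a'_def J'_def sgn_pt_def fun_eq_iff)
    also have "\<dots> = kuhn_vertex p d s' a' \<pi> i"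
      using kuhn_vertex_vert[of J' \<pi> i s' a'] J'1 \<pi>1 i assms(2) by simp
    finally show "x \<in> kuhn_vertex p d s' a' \<pi> ` {0..d}"
      using i x assms(2) by auto
  qed
  ultimately show ?thesis by blast
qed

text \<open>Faces of any dimension, in their inherited order. The condition is put on each vertex
  separately, since the labeling is equivariant vertex by vertex.\<close>

definition bdry_list :: "nat \<Rightarrow> (nat \<Rightarrow> star_point) list \<Rightarrow> bool" where
  "bdry_list k xs \<longleftrightarrow> (\<exists>ys. kuhn_list k ys \<and> subseq xs ys) \<and>
     (\<forall>x\<in>set xs. \<exists>l\<in>{1..k}. \<exists>i<p. x l = sgn_pt p i m)"

lemma bdry_list_star_boundary:
  assumes "bdry_list k xs" "k \<le> d"
  shows "set xs \<subseteq> star_boundary p m d"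
proof
  fix x assume x: "x \<in> set xs"
  obtain ys where ys: "kuhn_list k ys" "subseq xs ys"
    using assms(1) by (auto simp: bdry_list_def)
  obtain y where "y \<in> set ys" "x = y"
    using list_emb_set[OF ys(2) x] by metis
  then have "x \<in> star_pow p m d"
    using kuhn_list_star_pow[OF ys(1)] by blast
  moreover obtain l i where "l \<in> {1..k}" "i < p" "x l = sgn_pt p i m"
    using assms(1) x unfolding bdry_list_def by blast
  then have "\<exists>l\<in>{1..d}. \<exists>i<p. x l = sgn_pt p i m"
    using assms(2) by (intro bexI[of _ l]) auto
  ultimately show "x \<in> star_boundary p m d"
    by (simp add: star_boundary_def)
qed

lemma bdry_list_map_rot:
  assumes "bdry_list k xs" "k \<le> d"
  shows "bdry_list k (map rot xs)"
proof -
  obtain ys where "kuhn_list k ys" "subseq xs ys"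
    using assms(1) by (auto simp: bdry_list_def)
  then have "kuhn_list k (map rot ys)" "subseq (map rot xs) (map rot ys)"
    by (auto intro: kuhn_list_map_rot subseq_map)
  moreover have "\<exists>l\<in>{1..k}. \<exists>i<p. rot x l = sgn_pt p i m" if x: "x \<in> set xs" for x
  proof -
    obtain l i where li: "l \<in> {1..k}" "i < p" "x l = sgn_pt p i m"
      using assms(1) x unfolding bdry_list_def by blast
    have "rot x l = theta p (x l)"
      using li(1) assms(2) by (simp add: theta_pow_def)
    also have "\<dots> = sgn_pt p ((i + 1) mod p) m"
      by (simp add: li(3) theta_sgn_pt) (simp add: sgn_pt_def)
    finally show ?thesis using li(1) p_pos by (meson mod_less_divisor)
  qed
  ultimately show ?thesis unfolding bdry_list_def by auto
qed

lemma bdry_list_map_funpow: "bdry_list k xs \<Longrightarrow> k \<le> d \<Longrightarrow> bdry_list k (map (rot ^^ i) xs)"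
proof (induction i)
  case (Suc i)
  then show ?case using bdry_list_map_rot[of k "map (rot ^^ i) xs"] by (simp add: o_def)
qed simp

text \<open>The prism over a face, split at \<open>x\<close>, is a face of the prism over the whole
  simplex, split at the same vertex.\<close>

lemma bdry_list_prism:
  assumes "bdry_list k (ys @ x # zs)" "Suc k \<le> d" "b < m"
  shows "bdry_list (Suc k) (map (put (Suc k) b) ys @ put (Suc k) b x # put (Suc k) (Suc b) x #
    map (put (Suc k) (Suc b)) zs)" (is "bdry_list _ ?ws")
proof -
  obtain vs where vs: "kuhn_list k vs" "subseq (ys @ x # zs) vs"
    using assms(1) by (auto simp: bdry_list_def)
  obtain us us' where us: "vs = us @ us'" "subseq ys us" "subseq (x # zs) us'"
    using list_emb_appendD[OF vs(2)] by blast
  obtain us1 us2 where us': "us' = us1 @ x # us2" "subseq zs us2"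
    using list_emb_ConsD[OF us(3)] by blast
  have "subseq ys (us @ us1)"
    using list_emb_append_mono[OF us(2), of "[]" us1] by simp
  then have "subseq ?ws (map (put (Suc k) b) (us @ us1) @ put (Suc k) b x #
      put (Suc k) (Suc b) x # map (put (Suc k) (Suc b)) us2)"
    by (intro list_emb_append_mono subseq_map) (simp_all add: us'(2) subseq_map)
  moreover have "kuhn_list (Suc k) (map (put (Suc k) b) (us @ us1) @ put (Suc k) b x #
      put (Suc k) (Suc b) x # map (put (Suc k) (Suc b)) us2)"
    by (rule kuhn_list_prism) (use vs(1) us us' assms in auto)
  moreover have "\<exists>l\<in>{1..Suc k}. \<exists>i<p. put (Suc k) c y l = sgn_pt p i m"
    if y: "y \<in> set (ys @ x # zs)" for y c
  proof -
    obtain l i where "l \<in> {1..k}" "i < p" "y l = sgn_pt p i m"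
      using assms(1) y unfolding bdry_list_def by blast
    then show ?thesis by (intro bexI[of _ l]) (auto simp: put_def)
  qed
  ultimately show ?thesis unfolding bdry_list_def by auto
qed

text \<open>The top is a facet of the simplex in the last prism, \<open>b = m - 1\<close>, that
  doubles the first vertex.\<close>

lemma bdry_list_top:
  assumes "kuhn_list k xs" "Suc k \<le> d"
  shows "bdry_list (Suc k) (map (put (Suc k) m) xs)"
proof (cases xs)
  case Nil
  then show ?thesis using assms(1) by (auto simp: kuhn_list_def)
next
  case (Cons x zs)
  have "kuhn_list (Suc k) (put (Suc k) (m - 1) x # map (put (Suc k) m) xs)"
    using kuhn_list_prism[of k "[]" x zs "m - 1"] assms Cons m_pos by simp
  then show ?thesis
    using p_pos by (auto simp: bdry_list_def put_def intro: list_emb_Cons)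
qed

section \<open>Boundary formulas for the chains\<close>

lemma sweep_diff: "sweep c (\<lambda>xs. f xs - g xs) xs = sweep c f xs - sweep c g xs"
  by (simp add: sweep_def prism_diff sum_subtractf)

lemma sweep_dvd:
  assumes "\<And>b ys x zs. b < m \<Longrightarrow> xs = ys @ x # zs \<Longrightarrow>
    q dvd f (map (put c b) ys @ put c b x # put c (Suc b) x # map (put c (Suc b)) zs)"
  shows "q dvd sweep c f xs"
  unfolding sweep_def by (intro dvd_sum prism_dvd assms) auto

text \<open>The prisms between consecutive levels telescope, so only levels \<open>m\<close> and
  \<open>0\<close> survive.\<close>

lemma sweep_cobd:
  "sweep c (cobd f) xs = f (map (put c m) xs) - f (map (put c 0) xs) - cobd (sweep c f) xs"
  using sum_lessThan_telescope[of "\<lambda>b. f (map (put c b) xs)" m]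
  by (simp add: sweep_def[abs_def] prism_cobd sum_subtractf cobd_sum)

lemma chain_diff: "chain k (\<lambda>xs. f xs - g xs) = chain k f - chain k g"
proof (induction k arbitrary: f g)
  case (Suc k)
  have "sweep (Suc k) (nu rot p (Suc k) (\<lambda>xs. f xs - g xs))
      = (\<lambda>xs. sweep (Suc k) (nu rot p (Suc k) f) xs - sweep (Suc k) (nu rot p (Suc k) g) xs)"
    by (simp add: sweep_diff[symmetric] nu_diff[symmetric])
  then show ?case by (simp add: Suc)
qed simp

text \<open>The arbitrary \<open>q\<close> covers both vanishing, with \<open>q = 0\<close>, and
  congruence modulo \<open>p\<close>.\<close>

lemma chain_dvd:
  "k \<le> d \<Longrightarrow> (\<And>xs. kuhn_list k xs \<Longrightarrow> q dvd f xs) \<Longrightarrow> q dvd chain k f"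
proof (induction k arbitrary: f)
  case 0
  then show ?case using kuhn_list_0 by simp
next
  case (Suc k)
  have "q dvd chain k (sweep (Suc k) (nu rot p (Suc k) f))"
    by (intro Suc.IH sweep_dvd nu_dvd Suc.prems(2) kuhn_list_map_funpow kuhn_list_prism)
      (use Suc.prems(1) in auto)
  then show ?case by simp
qed

lemma chain_cong:
  assumes "k \<le> d" "\<And>xs. kuhn_list k xs \<Longrightarrow> f xs = g xs"
  shows "chain k f = chain k g"
proof -
  have "0 dvd chain k (\<lambda>xs. f xs - g xs)"
    by (rule chain_dvd) (use assms in auto)
  then show ?thesis by (simp add: chain_diff)
qed

text \<open>For positive \<open>k\<close>, \<open>chain k\<close> applies \<open>nu\<close> of index
  \<open>k\<close> first, and \<open>nu_nu\<close> applies on star points; for \<open>k = 0\<close>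
  the origin is fixed by \<open>rot\<close>.\<close>

lemma chain_nu:
  assumes "k \<le> d"
  shows "chain k (nu rot p (Suc k) f) = 0"
proof (cases k)
  case 0
  have "rot (\<lambda>l\<in>{1..d}. Origin) = (\<lambda>l\<in>{1..d}. Origin)"
    by (auto simp: theta_pow_def)
  then show ?thesis using 0 by (simp add: nu_def tau_def)
next
  case (Suc k')
  have "0 dvd chain k' (sweep k (nu rot p k (nu rot p (Suc k) f)))"
  proof (intro chain_dvd sweep_dvd)
    fix xs b ys x zs
    assume *: "kuhn_list k' xs" "b < m" "xs = ys @ x # zs"
    let ?ws = "map (put k b) ys @ put k b x # put k (Suc b) x # map (put k (Suc b)) zs"
    have "kuhn_list k ?ws"
      using kuhn_list_prism[of k' ys x zs b] * assms Suc by simp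
    then have "nu rot p k (nu rot p (Suc k) f) ?ws = 0"
      by (intro nu_nu theta_pow_period) (use kuhn_list_star_pow in blast)
    then show "0 dvd nu rot p k (nu rot p (Suc k) f) ?ws" by simp
  qed (use assms Suc in simp)
  then show ?thesis using Suc by simp
qed

text \<open>The sum is \<open>h\<close> evaluated on \<open>W\<^sub>k\<close>, which is the boundary
  of \<open>Y\<^sub>k \<times> r\<close> plus its bottom \<open>Y\<^sub>k\<close>. What remains is
  the top and the sides, both in the boundary. The statement about lower chains is assumed so that
  the lemma can serve in the induction for \<open>chain_cobd_dvd\<close>.\<close>

lemma chain_sweep_cobd_aux:
  assumes "Suc k \<le> d" and h: "\<And>xs. bdry_list (Suc k) xs \<Longrightarrow> q dvd h xs"
    and IH: "\<And>h. (\<And>xs. bdry_list k xs \<Longrightarrow> q dvd h xs) \<Longrightarrow> q dvd chain k (cobd h)"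
  shows "q dvd chain k (sweep (Suc k) (cobd h)) + chain k h"
proof -
  have "chain k (sweep (Suc k) (cobd h)) = chain k (\<lambda>xs. h (map (put (Suc k) m) xs))
      - chain k (\<lambda>xs. h (map (put (Suc k) 0) xs)) - chain k (cobd (sweep (Suc k) h))"
    by (simp add: sweep_cobd[abs_def] chain_diff)
  moreover have "chain k (\<lambda>xs. h (map (put (Suc k) 0) xs)) = chain k h"
    by (rule chain_cong) (use assms(1) kuhn_list_put_0 in auto)
  moreover have "q dvd chain k (\<lambda>xs. h (map (put (Suc k) m) xs))"
    by (intro chain_dvd h bdry_list_top) (use assms(1) in auto)
  moreover have "q dvd chain k (cobd (sweep (Suc k) h))"
    by (intro IH sweep_dvd h bdry_list_prism) (use assms(1) in auto)
  ultimately show ?thesis by simp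
qed

text \<open>The boundary of \<open>Y\<^sub>k\<close> is supported on the boundary of the first \<open>k\<close> coordinates.\<close>

lemma chain_cobd_dvd:
  "k \<le> d \<Longrightarrow> (\<And>xs. bdry_list k xs \<Longrightarrow> q dvd h xs) \<Longrightarrow> q dvd chain k (cobd h)"
proof (induction k arbitrary: h)
  case 0
  have "bdry_list 0 []" using kuhn_list_0 by (auto simp: bdry_list_def)
  then show ?case using 0 by simp
next
  case (Suc k)
  have "q dvd chain k (sweep (Suc k) (cobd (nu rot p (Suc k) h))) + chain k (nu rot p (Suc k) h)"
    by (intro chain_sweep_cobd_aux nu_dvd Suc.prems(2) bdry_list_map_funpow Suc.IH)
      (use Suc.prems(1) in auto)
  moreover have "nu rot p (Suc k) (cobd h) = cobd (nu rot p (Suc k) h)"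
    by (rule ext) (rule nu_cobd)
  ultimately show ?case using chain_nu[of k h] Suc.prems(1) by simp
qed

lemma chain_sweep_cobd:
  assumes "Suc k \<le> d" and "\<And>xs. bdry_list (Suc k) xs \<Longrightarrow> q dvd h xs"
  shows "q dvd chain k (sweep (Suc k) (cobd h)) + chain k h"
proof (rule chain_sweep_cobd_aux[OF assms])
  show "q dvd chain k (cobd h)" if "\<And>xs. bdry_list k xs \<Longrightarrow> q dvd h xs" for h
    using assms(1) that by (intro chain_cobd_dvd) simp_all
qed

text \<open>The defect \<open>nu g - cobd f\<close> is divisible on the boundary, hence on
  \<open>W\<^sub>k\<close>. Its coboundary is \<open>nu\<close> of \<open>cobd g\<close>, which
  turns the sweep into \<open>chain (Suc k)\<close>, while \<open>chain_nu\<close> removes the term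
  with \<open>nu g\<close>.\<close>

lemma chain_cobd_step:
  assumes "Suc k \<le> d"
    and "\<And>xs. bdry_list (Suc k) xs \<Longrightarrow> q dvd nu rot p (Suc k) g xs - cobd f xs"
  shows "q dvd chain (Suc k) (cobd g) - chain k (cobd f)"
proof -
  let ?h = "\<lambda>xs. nu rot p (Suc k) g xs - cobd f xs"
  have "q dvd chain k (sweep (Suc k) (cobd ?h)) + chain k ?h"
    by (rule chain_sweep_cobd[OF assms])
  moreover have "cobd ?h = nu rot p (Suc k) (cobd g)"
    by (rule ext) (simp add: cobd_diff cobd_cobd nu_cobd)
  ultimately show ?thesis
    using chain_nu[of k g] assms(1) by (simp add: chain_diff)
qed

end

section \<open>The label complex\<close>

lemma star_minus_Origin:
  assumes "0 < p"
  shows "star p t - {Origin} = {Ray i j | i j. i < p \<and> j \<in> {1..t}}"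
proof -
  have "sgn_pt p i j = Ray i j" if "i < p" "j \<in> {1..t}" for i j
    using that by (simp add: sgn_pt_def)
  then show ?thesis unfolding star_def by force
qed

text \<open>The simplices of the \<open>t\<close>-fold join of the boundary of a \<open>(p - 1)\<close>-simplex.\<close>

definition rainbow_free :: "nat \<Rightarrow> nat \<Rightarrow> star_point set \<Rightarrow> bool" where
  "rainbow_free p t S \<longleftrightarrow> S \<subseteq> {Ray i j | i j. i < p \<and> j \<in> {1..t}} \<and>
     (\<forall>j\<in>{1..t}. \<exists>i<p. Ray i j \<notin> S)"

fun magnitude :: "star_point \<Rightarrow> nat" where
  "magnitude Origin = 0"
| "magnitude (Ray i j) = j"

text \<open>The least magnitude is a choice that rotation preserves. On a nonempty rainbow-free set
  the result is a nonempty proper subset of the signs.\<close>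

definition low_signs :: "nat \<Rightarrow> star_point set \<Rightarrow> nat set" where
  "low_signs p S = {i. i < p \<and> Ray i (Min (magnitude ` S)) \<in> S}"

text \<open>
  Adding \<open>1\<close> to every element of a set \<open>A\<close> of signs adds \<open>card A\<close> to the sum of \<open>A\<close>. Dividing by
  \<open>card A\<close>, which is invertible as \<open>p\<close> is prime and \<open>0 < card A < p\<close>, makes the sum equivariant.
\<close>

definition sign_class :: "nat \<Rightarrow> star_point set \<Rightarrow> nat" where
  "sign_class p S = ((SOME c. [c * card (low_signs p S) = 1] (mod p)) * \<Sum>(low_signs p S)) mod p"

lemma theta_Ray: "1 \<le> j \<Longrightarrow> theta p (Ray i j) = Ray (Suc i mod p) j"
  by (simp add: sgn_pt_def)

lemma inj_on_Suc_mod: "inj_on (\<lambda>i. Suc i mod p) {..<p}"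
  by (auto simp: inj_on_def mod_Suc split: if_splits)

lemma theta_image_Ray_iff:
  assumes "S \<subseteq> {Ray i j | i j. i < p \<and> j \<in> {1..t}}" "i < p"
  shows "Ray (Suc i mod p) j \<in> theta p ` S \<longleftrightarrow> Ray i j \<in> S"
proof
  assume "Ray (Suc i mod p) j \<in> theta p ` S"
  then obtain y where y: "y \<in> S" "theta p y = Ray (Suc i mod p) j" by force
  obtain i' j' where y': "y = Ray i' j'" "i' < p" "j' \<in> {1..t}" using y(1) assms(1) by blast
  then have "Suc i' mod p = Suc i mod p" "j' = j" using y(2) by (auto simp: sgn_pt_def)
  then have "i' = i" using inj_onD[OF inj_on_Suc_mod] y'(2) assms(2) by blast
  then show "Ray i j \<in> S" using y(1) y'(1) \<open>j' = j\<close> by simp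
next
  assume R: "Ray i j \<in> S"
  then have "1 \<le> j" using assms(1) by auto
  then have "theta p (Ray i j) = Ray (Suc i mod p) j" by (rule theta_Ray)
  then show "Ray (Suc i mod p) j \<in> theta p ` S" using R by force
qed

lemma Suc_mod_image: "0 < p \<Longrightarrow> (\<lambda>i. Suc i mod p) ` {..<p} = {..<p}"
  by (rule endo_inj_surj) (auto simp: inj_on_Suc_mod)

lemma rainbow_free_theta:
  assumes "0 < p" "rainbow_free p t S"
  shows "rainbow_free p t (theta p ` S)"
proof -
  have S: "S \<subseteq> {Ray i j | i j. i < p \<and> j \<in> {1..t}}"
    using assms(2) by (simp add: rainbow_free_def)
  have "\<exists>i<p. Ray i j \<notin> theta p ` S" if j: "j \<in> {1..t}" for j
  proof -
    obtain i where "i < p" "Ray i j \<notin> S"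
      using assms(2) j unfolding rainbow_free_def by blast
    then have "Ray (Suc i mod p) j \<notin> theta p ` S" "Suc i mod p < p"
      using theta_image_Ray_iff[OF S] assms(1) by auto
    then show ?thesis by blast
  qed
  moreover have "theta p ` S \<subseteq> {Ray i j | i j. i < p \<and> j \<in> {1..t}}"
  proof
    fix y assume "y \<in> theta p ` S"
    then obtain i j where "y = theta p (Ray i j)" "j \<in> {1..t}" using S by blast
    then show "y \<in> {Ray i j | i j. i < p \<and> j \<in> {1..t}}"
      using assms(1) by (auto simp: sgn_pt_def)
  qed
  ultimately show ?thesis by (simp add: rainbow_free_def)
qed

lemma sign_class_theta:
  assumes "prime p" and good: "rainbow_free p t S" and "S \<noteq> {}"
  shows "sign_class p (theta p ` S) = (sign_class p S + 1) mod p"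
proof -
  have p: "0 < p" using assms(1) by (simp add: prime_gt_0_nat)
  have S: "S \<subseteq> {Ray i j | i j. i < p \<and> j \<in> {1..t}}"
    using good by (simp add: rainbow_free_def)
  define j where "j = Min (magnitude ` S)"
  define A where "A = low_signs p S"
  have A: "A = {i. i < p \<and> Ray i j \<in> S}" by (simp add: A_def low_signs_def j_def)
  have fin: "finite A" by (simp add: A)
  have "magnitude ` S \<subseteq> {1..t}" using S by force
  then have "finite (magnitude ` S)" using finite_subset by blast
  then have "j \<in> magnitude ` S" using \<open>S \<noteq> {}\<close> by (simp add: j_def)
  then obtain i0 where i0: "i0 < p" "Ray i0 j \<in> S" "j \<in> {1..t}" using S by force
  then have "0 < card A" using fin by (auto simp: card_gt_0_iff A)
  moreover have "card A < p"
  proof -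
    have "A \<subset> {..<p}" using good i0(3) unfolding rainbow_free_def A by blast
    then show ?thesis using psubset_card_mono[of "{..<p}" A] by simp
  qed
  ultimately have "coprime (card A) p"
    using assms(1) by (meson coprime_commute nat_dvd_not_less prime_imp_coprime)
  define c where "c = (SOME c. [c * card A = 1] (mod p))"
  have "\<exists>c. [c * card A = 1] (mod p)"
    using cong_solve_coprime_nat[OF \<open>coprime (card A) p\<close>] by (auto simp: mult.commute)
  then have c: "[c * card A = 1] (mod p)" unfolding c_def by (rule someI_ex)
  have "magnitude (theta p y) = magnitude y" if y: "y \<in> S" for y
  proof -
    obtain i j where "y = Ray i j" "1 \<le> j" using y S by fastforce
    then show ?thesis by (simp add: sgn_pt_def)
  qed
  \<comment> \<open>The least magnitude of the rotated set is therefore again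
    \<open>j\<close>.\<close>
  then have "magnitude ` theta p ` S = magnitude ` S"
    by (simp add: image_image)
  then have "low_signs p (theta p ` S) = {i. i < p \<and> Ray i j \<in> theta p ` S}"
    by (simp add: low_signs_def j_def)
  also have "\<dots> = (\<lambda>i. Suc i mod p) ` A"
  proof (intro set_eqI iffI)
    fix i assume i: "i \<in> {i. i < p \<and> Ray i j \<in> theta p ` S}"
    then have "i \<in> (\<lambda>i. Suc i mod p) ` {..<p}"
      unfolding Suc_mod_image[OF p] by simp
    then obtain i' where "i' < p" "i = Suc i' mod p" by blast
    then show "i \<in> (\<lambda>i. Suc i mod p) ` A"
      using i theta_image_Ray_iff[OF S, of i' j] by (auto simp: A)
  next
    fix i assume "i \<in> (\<lambda>i. Suc i mod p) ` A"
    then show "i \<in> {i. i < p \<and> Ray i j \<in> theta p ` S}"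
      using theta_image_Ray_iff[OF S] p by (auto simp: A)
  qed
  finally have low: "low_signs p (theta p ` S) = (\<lambda>i. Suc i mod p) ` A" .
  have inj: "inj_on (\<lambda>i. Suc i mod p) A"
    by (rule inj_on_subset[OF inj_on_Suc_mod]) (auto simp: A)
  have "sign_class p (theta p ` S) = (c * (\<Sum>i\<in>A. Suc i mod p)) mod p"
    using inj by (simp add: sign_class_def low card_image c_def sum.reindex)
  also have "\<dots> = (c * (\<Sum>i\<in>A. Suc i)) mod p"
    by (metis mod_mult_right_eq mod_sum_eq)
  also have "(\<Sum>i\<in>A. Suc i) = \<Sum>A + card A"
    by (simp add: sum_Suc)
  also have "(c * (\<Sum>A + card A)) mod p = (c * \<Sum>A + c * card A) mod p"
    by (simp add: algebra_simps)
  also have "\<dots> = (c * \<Sum>A + 1) mod p"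
    using c unfolding cong_def by (metis mod_add_right_eq)
  also have "\<dots> = (sign_class p S + 1) mod p"
    unfolding sign_class_def A_def[symmetric] c_def[symmetric] by (simp add: mod_Suc_eq)
  finally show ?thesis .
qed

lemma free_cyclic_complex_labels:
  assumes "prime p"
  shows "free_cyclic_complex (theta p) p (rainbow_free p t) (sign_class p)"
proof
  show p: "0 < p" using assms by (simp add: prime_gt_0_nat)
  show "rainbow_free p t R" if "rainbow_free p t S" "R \<subseteq> S" for S R
    using that unfolding rainbow_free_def by blast
  show "rainbow_free p t (theta p ` S)" if "rainbow_free p t S" for S
    using rainbow_free_theta p that by blast
  show "(theta p ^^ p) x = x" if "rainbow_free p t S" "x \<in> S" for S x
  proof (rule theta_period)
    show "x \<in> star p t"
      using that star_minus_Origin[OF p, of t] unfolding rainbow_free_def by blast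
  qed
  show "sign_class p S < p" for S
    using p by (simp add: sign_class_def)
  show "sign_class p (theta p ` S) = (sign_class p S + 1) mod p"
    if "rainbow_free p t S" "S \<noteq> {}" for S
    using sign_class_theta assms that by blast
qed

text \<open>Each of the \<open>t\<close> magnitudes lacks a sign and so contributes at most
  \<open>p - 1\<close> points. This bounds the dimension of \<open>K\<close>.\<close>

lemma card_rainbow_free:
  assumes "rainbow_free p t S"
  shows "card S \<le> t * (p - 1)"
proof -
  define A where "A j = {i. i < p \<and> Ray i j \<in> S}" for j
  have "card ((\<lambda>i. Ray i j) ` A j) \<le> p - 1" if j: "j \<in> {1..t}" for j
  proof -
    have "A j \<subset> {..<p}" using assms j unfolding rainbow_free_def A_def by blast
    then have "card (A j) < p" using psubset_card_mono[of "{..<p}" "A j"] by simp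
    moreover have "card ((\<lambda>i. Ray i j) ` A j) \<le> card (A j)"
      by (rule card_image_le) (simp add: A_def)
    ultimately show ?thesis by linarith
  qed
  then have "(\<Sum>j\<in>{1..t}. card ((\<lambda>i. Ray i j) ` A j)) \<le> t * (p - 1)"
    using sum_bounded_above[of "{1..t}" "\<lambda>j. card ((\<lambda>i. Ray i j) ` A j)" "p - 1"] by simp
  moreover have "S = (\<Union>j\<in>{1..t}. (\<lambda>i. Ray i j) ` A j)"
    using assms unfolding rainbow_free_def A_def by blast
  moreover have "card (\<Union>j\<in>{1..t}. (\<lambda>i. Ray i j) ` A j)
      \<le> (\<Sum>j\<in>{1..t}. card ((\<lambda>i. Ray i j) ` A j))"
    by (rule card_UN_le) simp
  ultimately show ?thesis by simp
qed

theorem mainTheorem12: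
  fixes p m t d :: nat and lab :: "(nat \<Rightarrow> star_point) \<Rightarrow> star_point"
  assumes "prime p" and "m \<ge> 1" and "t \<ge> 1" and "d = t * (p - 1)"
    and "lab \<in> star_pow p m d \<rightarrow> star p t - {Origin}"
    and "\<forall>x\<in>star_boundary p m d. lab (theta_pow p d x) = theta p (lab x)"
  shows "\<exists>x j. x ` {1..p} \<in> kuhn_triangulation p m d \<and> card (x ` {1..p}) = p \<and>
           j \<in> {1..t} \<and> (\<forall>i\<in>{1..p}. lab (x i) = sgn_pt p i j)"
proof (rule ccontr)
  assume contra: "\<not> ?thesis"
  have p: "0 < p" using assms(1) by (simp add: prime_gt_0_nat)
  interpret star_grid p m d
    by unfold_locales (use p assms(2) in auto)
  interpret labels: free_cyclic_complex "theta p" p "rainbow_free p t" "sign_class p"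
    by (rule free_cyclic_complex_labels[OF assms(1)])
  have free: "rainbow_free p t (lab ` set xs)" if xs: "kuhn_list k xs" "k \<le> d" for k xs
  proof -
    have "lab ` set xs \<subseteq> {Ray i j | i j. i < p \<and> j \<in> {1..t}}"
      using kuhn_list_star_pow[OF xs(1)] assms(5) unfolding star_minus_Origin[OF p] by blast
    moreover have "\<exists>i<p. Ray i j \<notin> lab ` set xs" if j: "j \<in> {1..t}" for j
    proof (rule ccontr)
      assume "\<not> ?thesis"
      \<comment> \<open>Indices run from \<open>1\<close> to \<open>p\<close>, so index
        \<open>p\<close> stands for sign \<open>0\<close>.\<close>
      then have "\<forall>i\<in>{1..p}. \<exists>y. y \<in> set xs \<and> lab y = Ray (i mod p) j"
        using p by (metis imageE mod_less_divisor)
      then obtain x where x: "\<forall>i\<in>{1..p}. x i \<in> set xs \<and> lab (x i) = Ray (i mod p) j"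
        by metis
      have lab_x: "lab (x i) = sgn_pt p i j" if "i \<in> {1..p}" for i
        using x that j by (simp add: sgn_pt_def)
      obtain \<tau> where "\<tau> \<in> kuhn_facets p m d" "set xs \<subseteq> \<tau>"
        using kuhn_list_facet[OF xs] by blast
      moreover have "x ` {1..p} \<subseteq> set xs" "x ` {1..p} \<noteq> {}" using x p by auto
      ultimately have "x ` {1..p} \<in> kuhn_triangulation p m d"
        unfolding kuhn_triangulation_def by blast
      \<comment> \<open>Distinct labels force distinct vertices.\<close>
      moreover have "inj_on x {1..p}"
      proof (rule inj_onI)
        fix i i' assume i: "i \<in> {1..p}" "i' \<in> {1..p}" "x i = x i'"
        then have "i mod p = i' mod p" using x by (metis star_point.inject)
        then show "i = i'" using i p by (cases "i = p"; cases "i' = p") auto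
      qed
      then have "card (x ` {1..p}) = p" by (simp add: card_image)
      ultimately show False using contra lab_x j by blast
    qed
    ultimately show ?thesis by (simp add: rainbow_free_def)
  qed
  \<comment> \<open>The pullback of \<open>\<psi>\<^sub>k\<close> along the labeling. As
    \<open>lab\<close> is equivariant only on the boundary, the relation \<open>nu_g\<close> is
    claimed only there.\<close>
  define g where "g k xs = label_cochain (theta p) p (sign_class p) k (map lab xs)" for k xs
  have cobd_g: "cobd (g k) xs = cobd (label_cochain (theta p) p (sign_class p) k) (map lab xs)"
    for k xs by (simp add: g_def[abs_def] cobd_map)
  have nu_g: "int p dvd nu rot p (Suc k) (g (Suc k)) xs - cobd (g k) xs"
    if xs: "bdry_list (Suc k) xs" "Suc k \<le> d" for k xs
  proof -
    have map_lab: "map lab (map (rot ^^ i) xs) = map (theta p ^^ i) (map lab xs)" for i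
    proof (induction i)
      case (Suc i)
      have "set (map (rot ^^ i) xs) \<subseteq> star_boundary p m d"
        by (rule bdry_list_star_boundary[OF bdry_list_map_funpow[OF xs] xs(2)])
      then have "map lab (map rot (map (rot ^^ i) xs)) = map (theta p) (map lab (map (rot ^^ i) xs))"
        using assms(6) by auto
      then show ?case using Suc by (simp add: o_def)
    qed simp
    have "nu rot p (Suc k) (g (Suc k)) xs
        = nu (theta p) p (Suc k) (label_cochain (theta p) p (sign_class p) (Suc k)) (map lab xs)"
      using map_lab map_lab[of 1] by (simp add: nu_def tau_def nrm_def g_def del: map_map)
    moreover obtain ys where ys: "kuhn_list (Suc k) ys" "subseq xs ys"
      using xs(1) by (auto simp: bdry_list_def)
    have "set xs \<subseteq> set ys"
      using list_emb_set[OF ys(2)] by (metis subsetI)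
    then have "rainbow_free p t (set (map lab xs))"
      using labels.good_subset[OF free[OF ys(1) xs(2)]] by (simp add: image_mono)
    ultimately show ?thesis using labels.nu_label_cochain by (simp add: cobd_g)
  qed
  \<comment> \<open>The value is \<open>1\<close> for \<open>k = 0\<close> because of the
    augmentation, and each step preserves it modulo \<open>p\<close>.\<close>
  have "int p dvd chain k (cobd (g k)) - 1" if "k \<le> d" for k
    using that
  proof (induction k)
    case 0
    then show ?case by (simp add: g_def)
  next
    case (Suc k)
    have "int p dvd chain (Suc k) (cobd (g (Suc k))) - chain k (cobd (g k))"
      by (rule chain_cobd_step[OF Suc.prems nu_g[OF _ Suc.prems]])
    from dvd_add[OF this Suc.IH] Suc.prems show ?case by simp
  qed
  from this[of d] have "int p dvd chain d (cobd (g d)) - 1" by simp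
  moreover have "chain d (cobd (g d)) = 0"
  proof -
    have "cobd (g d) xs = 0" if xs: "kuhn_list d xs" for xs
    proof -
      \<comment> \<open>The \<open>d + 1\<close> vertices carry at most \<open>d\<close> labels, so
        a label repeats and the alternating cochain vanishes.\<close>
      have "card (set (map lab xs)) \<le> d"
        using card_rainbow_free[OF free[OF xs]] assms(4) by simp
      moreover have "length (map lab xs) = Suc d"
        using xs by (auto simp: kuhn_list_def)
      ultimately have "\<not> distinct (map lab xs)"
        using distinct_card[of "map lab xs"] by linarith
      then show ?thesis
        unfolding cobd_g
        by (rule alternating_not_distinct[OF alternating_cobd[OF alternating_label_cochain]])
    qed
    then have "0 dvd chain d (cobd (g d))" by (intro chain_dvd) auto
    then show ?thesis by simp
  qed
  ultimately have "int p dvd 1" by simp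
  then show False using assms(1) by (simp add: prime_gt_1_nat)
qed

end
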